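(* Let $J\subsetneq I\subset S=K[x_1,\ldots,x_n]$ be monomial ideals, let $g$ and the characteristic poset $P^g_{I/J}$ be as in the context, and let $\mathcal{D}$ be a Stanley decomposition of $I/J$. Then there exists a partition $\mathcal{P}$ of $P^g_{I/J}$ into intervals such that $$\operatorname{sdepth}\mathcal{D}(\mathcal{P})\ge\operatorname{sdepth}\mathcal{D}.$$ In particular, $\operatorname{sdepth}(I/J)$ is the maximum of the numbers $\operatorname{sdepth}\mathcal{D}(\mathcal{P})$, where $\mathcal{P}$ runs over the (finitely many) partitions of $P^g_{I/J}$.
   Context: $K$ is a field and $S=K[x_1,\ldots,x_n]$ with its $\mathbb{Z}^n$-grading. For a finitely generated $\mathbb{Z}^n$-graded $S$-module $M$, a homogeneous $u\in M$ and $Z\subset\{x_1,\ldots,x_n\}$, $uK[Z]$ denotes the $K$-subspace of $M$ generated by all $uv$ with $v$ a monomial in $K[Z]$; it is a Stanley space of dimension $|Z|$ if it is a free $K[Z]$-module. A Stanley decomposition of $M$ is a presentation $\mathcal{D}: M=\bigoplus_{i=1}^m u_iK[Z_i]$ of $M$ as a finite direct sum of Stanley spaces, as $\mathbb{Z}^n$-graded $K$-vector spaces; $\operatorname{sdepth}\mathcal{D}=\min\{|Z_i|\}$, and $\operatorname{sdepth}M$ is the maximum of $\operatorname{sdepth}\mathcal{D}$ over all Stanley decompositions $\mathcal{D}$ of $M$. For $a\in\mathbb{N}^n$ (with $0\in\mathbb{N}$), $x^a=x_1^{a(1)}\cdots x_n^{a(n)}$; $\mathbb{N}^n$ is partially ordered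 componentwise. Let $I$ be generated by monomials $x^{a_1},\ldots,x^{a_t}$ and $J$ by monomials $x^{b_1},\ldots,x^{b_s}$ (no $b_j$'s if $J=0$). Fix $g\in\mathbb{N}^n$ with $a_i\le g$ and $b_j\le g$ for all $i,j$. The characteristic poset of $I/J$ with respect to $g$ is $P^g_{I/J}=\{c\in\mathbb{N}^n: c\le g,\ a_i\le c \text{ for some } i,\ c\not\ge b_j\text{ for all } j\}$, a finite subposet of $\mathbb{N}^n$. For $a\le b$ in a poset $P$, $[a,b]=\{c\in P: a\le c\le b\}$ is an interval; a partition of a finite poset $P$ is a presentation $P=\bigcup_{i=1}^r[a_i,b_i]$ as a disjoint union of (nonempty) intervals. For $b\in P^g_{I/J}$ set $Z_b=\{x_j: b(j)=g(j)\}$. The module $I/J$ is identified with the $K$-span of the monomials in $I\setminus J$. Each partition $\mathcal{P}: P^g_{I/J}=\bigcup_{i=1}^r[c_i,d_i]$ gives the Stanley decomposition $\mathcal{D}(\mathcal{P}): I/J=\bigoplus_{i=1}^r\big(\bigoplus_c x^cK[Z_{d_i}]\big)$, where the inner sum is over all $c\in[c_i,d_i]$ with $c(j)=c_i(j)$ for all $j$ with $x_j\in Z_{d_i}$. *)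

theory Defs
  imports
    "HOL-Library.Poly_Mapping"
    "HOL-Library.Function_Algebras"
    "HOL-Library.FuncSet"
    "HOL-Library.Disjoint_Sets"
    "HOL-Algebra.QuotRing"
    "HOL-Algebra.Module"
    "HOL-Algebra.Algebraic_Closure_Type"
begin

section \<open>The polynomial ring\<close>

text \<open>
  The variables \<open>x\<^sub>1, \<dots>, x\<^sub>n\<close> are indexed by a finite type \<open>'n\<close>.  An exponent vector is a function
  \<open>'n \<Rightarrow> nat\<close>; addition and order of exponent vectors are the componentwise ones.  The polynomial
  ring is the monoid algebra of the exponent vectors, with the multiplication of
  \<^theory>\<open>HOL-Library.Poly_Mapping\<close>.
\<close>

type_synonym ('n, 'k) mpoly = "('n \<Rightarrow> nat) \<Rightarrow>\<^sub>0 'k"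

abbreviation mpoly_ring :: "('n, 'k::field) mpoly ring" where
  "mpoly_ring \<equiv> ring_of_type_algebra"

definition xpow :: "('n \<Rightarrow> nat) \<Rightarrow> ('n, 'k::field) mpoly" where
  "xpow a = Poly_Mapping.single a 1"

definition const_mpoly :: "'k::field \<Rightarrow> ('n, 'k) mpoly" where
  "const_mpoly c = Poly_Mapping.single 0 c"

definition exponents_in :: "'n set \<Rightarrow> ('n \<Rightarrow> nat) set" where
  "exponents_in Z = {a. \<forall>j. j \<notin> Z \<longrightarrow> a j = 0}"

text \<open>The subring \<open>K[Z]\<close>.\<close>

definition polys_in :: "'n set \<Rightarrow> ('n, 'k::field) mpoly set" where
  "polys_in Z = {p. Poly_Mapping.keys p \<subseteq> exponents_in Z}"

definition monomial_ideal :: "('n \<Rightarrow> nat) set \<Rightarrow> ('n, 'k::field) mpoly set" where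
  "monomial_ideal A = Idl\<^bsub>mpoly_ring\<^esub> (xpow ` A)"

definition homogeneous_poly :: "('n \<Rightarrow> int) \<Rightarrow> ('n, 'k::field) mpoly \<Rightarrow> bool" where
  "homogeneous_poly \<delta> p \<longleftrightarrow> (\<forall>a \<in> Poly_Mapping.keys p. (\<lambda>j. int (a j)) = \<delta>)"


section \<open>Stanley decompositions of multigraded modules\<close>

text \<open>
  A multigraded module is given by a module \<open>M\<close> over the polynomial ring together with its family
  \<open>G\<close> of homogeneous components, indexed by \<open>\<int>\<^sup>n\<close>.
\<close>

definition K_subspace :: "(('n, 'k::field) mpoly, 'm) module \<Rightarrow> 'm set \<Rightarrow> bool" where
  "K_subspace M U \<longleftrightarrow>
     U \<subseteq> carrier M \<and> \<zero>\<^bsub>M\<^esub> \<in> U \<and>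
     (\<forall>x\<in>U. \<forall>y\<in>U. x \<oplus>\<^bsub>M\<^esub> y \<in> U) \<and>
     (\<forall>c. \<forall>x\<in>U. const_mpoly c \<odot>\<^bsub>M\<^esub> x \<in> U)"

definition K_span :: "(('n, 'k::field) mpoly, 'm) module \<Rightarrow> 'm set \<Rightarrow> 'm set" where
  "K_span M Y = \<Inter> {U. K_subspace M U \<and> Y \<subseteq> U}"

text \<open>The subspace \<open>uK[Z]\<close>.\<close>

definition stanley_span ::
  "(('n, 'k::field) mpoly, 'm) module \<Rightarrow> 'm \<Rightarrow> 'n set \<Rightarrow> 'm set" where
  "stanley_span M u Z = K_span M ((\<lambda>a. xpow a \<odot>\<^bsub>M\<^esub> u) ` exponents_in Z)"

text \<open>
  \<open>uK[Z]\<close> is a Stanley space if it is free over \<open>K[Z]\<close>, that is, if \<open>u\<close> has no nonzero annihilator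
  in \<open>K[Z]\<close>, so that \<open>{u}\<close> is a basis.  In particular \<open>u\<close> is nonzero.
\<close>

definition stanley_space ::
  "(('n, 'k::field) mpoly, 'm) module \<Rightarrow> (('n \<Rightarrow> int) \<Rightarrow> 'm set) \<Rightarrow> 'm \<Rightarrow> 'n set \<Rightarrow> bool" where
  "stanley_space M G u Z \<longleftrightarrow>
     u \<in> carrier M \<and> (\<exists>\<delta>. u \<in> G \<delta>) \<and>
     (\<forall>p \<in> polys_in Z. p \<odot>\<^bsub>M\<^esub> u = \<zero>\<^bsub>M\<^esub> \<longrightarrow> p = 0)"

definition internal_direct_sum ::
  "(('n, 'k::field) mpoly, 'm) module \<Rightarrow> 'i set \<Rightarrow> ('i \<Rightarrow> 'm set) \<Rightarrow> bool" where
  "internal_direct_sum M T W \<longleftrightarrow>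
     (\<forall>i\<in>T. K_subspace M (W i)) \<and>
     (\<forall>x \<in> carrier M. \<exists>!w. w \<in> (\<Pi>\<^sub>E i\<in>T. W i) \<and> x = (\<Oplus>\<^bsub>M\<^esub>i\<in>T. w i))"

text \<open>
  A Stanley decomposition is encoded as the finite set of its pairs \<open>(u\<^sub>i, Z\<^sub>i)\<close>.  Since the summands of
  a direct sum of nonzero spaces are distinct, no multiplicities are lost.
\<close>

definition stanley_decomposition ::
  "(('n, 'k::field) mpoly, 'm) module \<Rightarrow> (('n \<Rightarrow> int) \<Rightarrow> 'm set) \<Rightarrow> ('m \<times> 'n set) set \<Rightarrow> bool" where
  "stanley_decomposition M G D \<longleftrightarrow>
     finite D \<and> (\<forall>(u, Z) \<in> D. stanley_space M G u Z) \<and>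
     internal_direct_sum M D (\<lambda>(u, Z). stanley_span M u Z)"

definition sdepth_decomp :: "('m \<times> 'n set) set \<Rightarrow> nat" where
  "sdepth_decomp D = Min ((\<lambda>(u, Z). card Z) ` D)"

definition sdepth ::
  "(('n, 'k::field) mpoly, 'm) module \<Rightarrow> (('n \<Rightarrow> int) \<Rightarrow> 'm set) \<Rightarrow> nat" where
  "sdepth M G = Max {sdepth_decomp D | D. stanley_decomposition M G D}"


section \<open>The module \<open>I/J\<close>\<close>

text \<open>
  The elements of \<open>I/J\<close> are the cosets \<open>J + f\<close> with \<open>f \<in> I\<close>.  The fields \<open>mult\<close> and \<open>one\<close> are present
  because the type of modules extends that of rings; they play no role for modules.
\<close>

definition quot_module ::
  "('n, 'k::field) mpoly set \<Rightarrow> ('n, 'k) mpoly set \<Rightarrow>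
     (('n, 'k) mpoly, ('n, 'k) mpoly set) module" where
  "quot_module I J =
     \<lparr>partial_object.carrier = (\<lambda>f. J +>\<^bsub>mpoly_ring\<^esub> f) ` I,
      monoid.mult = rcoset_mult mpoly_ring J,
      monoid.one = J +>\<^bsub>mpoly_ring\<^esub> \<one>\<^bsub>mpoly_ring\<^esub>,
      ring.zero = J,
      ring.add = set_add mpoly_ring,
      module.smult = (\<lambda>p Y. rcoset_mult mpoly_ring J (J +>\<^bsub>mpoly_ring\<^esub> p) Y)\<rparr>"

definition quot_component ::
  "('n, 'k::field) mpoly set \<Rightarrow> ('n, 'k) mpoly set \<Rightarrow>
     ('n \<Rightarrow> int) \<Rightarrow> ('n, 'k) mpoly set set" where
  "quot_component I J \<delta> = {J +>\<^bsub>mpoly_ring\<^esub> f | f. f \<in> I \<and> homogeneous_poly \<delta> f}"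

lemma quot_module_module:
  fixes I J :: "('n, 'k::field) mpoly set"
  assumes I: "ideal I mpoly_ring" and J: "ideal J mpoly_ring"
  shows "module mpoly_ring (quot_module I J)"
proof -
  let ?R = "mpoly_ring :: ('n, 'k) mpoly ring"
  interpret R: cring ?R by (rule cring_from_type_algebra)
  interpret I: ideal I ?R by fact
  interpret J: ideal J ?R by fact
  interpret Q: cring "?R Quot J" by (rule J.quotient_is_cring) (rule R.is_cring)
  have car: "carrier ?R = UNIV" by (simp add: ring_of_type_algebra_def)
  have IQ: "J +>\<^bsub>?R\<^esub> f \<in> carrier (?R Quot J)" for f
    unfolding FactRing_def A_RCOSETS_def' using car by auto
  have sub: "Y \<in> carrier (quot_module I J) \<Longrightarrow> Y \<in> carrier (?R Quot J)" for Y
    using IQ by (auto simp: quot_module_def)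
  have ops: "add (quot_module I J) = add (?R Quot J)" "zero (quot_module I J) = zero (?R Quot J)"
    "p \<odot>\<^bsub>quot_module I J\<^esub> Y = (J +>\<^bsub>?R\<^esub> p) \<otimes>\<^bsub>?R Quot J\<^esub> Y" for p Y
    by (simp_all add: quot_module_def FactRing_def)
  have hadd: "(J +>\<^bsub>?R\<^esub> f) \<oplus>\<^bsub>?R Quot J\<^esub> (J +>\<^bsub>?R\<^esub> h) = J +>\<^bsub>?R\<^esub> (f \<oplus>\<^bsub>?R\<^esub> h)" for f h
    using J.a_rcos_sum[of f h] car by (simp add: FactRing_def)
  have hmult: "(J +>\<^bsub>?R\<^esub> f) \<otimes>\<^bsub>?R Quot J\<^esub> (J +>\<^bsub>?R\<^esub> h) = J +>\<^bsub>?R\<^esub> (f \<otimes>\<^bsub>?R\<^esub> h)" for f h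
    using J.rcoset_mult_add[of f h] car by (simp add: FactRing_def)
  have hz: "zero (?R Quot J) = J +>\<^bsub>?R\<^esub> \<zero>\<^bsub>?R\<^esub>"
    by (simp add: FactRing_def a_r_coset_def r_coset_def ring_of_type_algebra_def)
  have closed: "Y \<in> carrier (quot_module I J) \<longleftrightarrow> (\<exists>f\<in>I. Y = J +>\<^bsub>?R\<^esub> f)" for Y
    by (auto simp: quot_module_def)
  have inI: "f \<in> I \<Longrightarrow> h \<in> I \<Longrightarrow> f \<oplus>\<^bsub>?R\<^esub> h \<in> I" "f \<in> I \<Longrightarrow> p \<otimes>\<^bsub>?R\<^esub> f \<in> I" "\<zero>\<^bsub>?R\<^esub> \<in> I" "f \<in> I \<Longrightarrow> \<ominus>\<^bsub>?R\<^esub> f \<in> I" for f h p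
    using car by (auto intro: I.a_closed I.I_l_closed)
  show ?thesis
  proof (rule moduleI)
    show "abelian_group (quot_module I J)"
    proof (rule abelian_groupI, goal_cases)
      case (1 x y) then show ?case using hadd inI by (auto simp: closed ops)
    next
      case 2 then show ?case using hz inI by (auto simp: closed ops)
    next
      case (3 x y z) then show ?case using sub by (simp add: ops Q.a_assoc)
    next
      case (4 x y) then show ?case using sub by (simp add: ops Q.a_comm)
    next
      case (5 x) then show ?case using sub by (simp add: ops)
    next
      case (6 x)
      then obtain f where f: "f \<in> I" "x = J +>\<^bsub>?R\<^esub> f" by (auto simp: closed)
      have "(J +>\<^bsub>?R\<^esub> (\<ominus>\<^bsub>?R\<^esub> f)) \<oplus>\<^bsub>?R Quot J\<^esub> x = zero (?R Quot J)"
        unfolding f hadd hz using car R.l_neg[of f] by simp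
      moreover have "J +>\<^bsub>?R\<^esub> (\<ominus>\<^bsub>?R\<^esub> f) \<in> carrier (quot_module I J)"
        using inI(4)[OF f(1)] by (auto simp: closed)
      ultimately show ?case by (auto simp: ops)
    qed
  next
    fix p Y assume "Y \<in> carrier (quot_module I J)"
    then show "p \<odot>\<^bsub>quot_module I J\<^esub> Y \<in> carrier (quot_module I J)"
      using hmult inI by (auto simp: closed ops)
  next
    fix Y assume "Y \<in> carrier (quot_module I J)"
    then show "\<one>\<^bsub>?R\<^esub> \<odot>\<^bsub>quot_module I J\<^esub> Y = Y"
      using hmult car by (auto simp: closed ops)
  qed (use IQ sub in \<open>simp_all add: ops Q.l_distr Q.r_distr Q.m_assoc flip: hadd hmult\<close>, rule R.is_cring)
qed


section \<open>Partitions of posets into intervals and the characteristic poset\<close>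

definition poset_interval :: "'a::order set \<Rightarrow> 'a \<Rightarrow> 'a \<Rightarrow> 'a set" where
  "poset_interval P a b = {c \<in> P. a \<le> c \<and> c \<le> b}"

text \<open>A partition into nonempty intervals \<open>[a, b]\<close>, encoded as the set of the pairs \<open>(a, b)\<close>.\<close>

definition interval_partition :: "'a::order set \<Rightarrow> ('a \<times> 'a) set \<Rightarrow> bool" where
  "interval_partition P \<P> \<longleftrightarrow>
     (\<forall>(a, b) \<in> \<P>. a \<in> P \<and> b \<in> P \<and> a \<le> b) \<and>
     disjoint_family_on (\<lambda>(a, b). poset_interval P a b) \<P> \<and>
     P = (\<Union>(a, b) \<in> \<P>. poset_interval P a b)"

definition char_poset ::
  "('n \<Rightarrow> nat) set \<Rightarrow> ('n \<Rightarrow> nat) set \<Rightarrow> ('n \<Rightarrow> nat) \<Rightarrow> ('n \<Rightarrow> nat) set" where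
  "char_poset A B g = {c. c \<le> g \<and> (\<exists>a\<in>A. a \<le> c) \<and> (\<forall>b\<in>B. \<not> b \<le> c)}"

definition vars_at :: "('n \<Rightarrow> nat) \<Rightarrow> ('n \<Rightarrow> nat) \<Rightarrow> 'n set" where
  "vars_at g b = {j. b j = g j}"

text \<open>The decomposition \<open>\<D>(\<P>)\<close> of \<open>I/J\<close>; the generators are the residue classes of the \<open>x\<^sup>c\<close>.\<close>

definition decomp_of_partition ::
  "('n, 'k::field) mpoly set \<Rightarrow> ('n \<Rightarrow> nat) set \<Rightarrow> ('n \<Rightarrow> nat) \<Rightarrow>
     (('n \<Rightarrow> nat) \<times> ('n \<Rightarrow> nat)) set \<Rightarrow> (('n, 'k) mpoly set \<times> 'n set) set" where
  "decomp_of_partition J P g \<P> =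
     {(J +>\<^bsub>mpoly_ring\<^esub> xpow c, vars_at g d) | a d c.
        (a, d) \<in> \<P> \<and> c \<in> poset_interval P a d \<and> (\<forall>j \<in> vars_at g d. c j = a j)}"

end

theory Submission
  imports Defs
begin

text \<open>
  A homogeneous element of \<open>I/J\<close> is a scalar multiple of the class of a monomial, and \<open>I/J\<close> has the
  monomials in \<open>I - J\<close> as a basis.  So a Stanley decomposition is the same as a finite partition of
  the exponents of these monomials into cones \<open>a + \<nat>\<^sup>Z\<close>.  Truncating at \<open>g\<close>, a cone with
  \<open>a \<le> g\<close> becomes the interval from \<open>a\<close> to the vector that is \<open>g\<close> on \<open>Z\<close> and \<open>a\<close> elsewhere, and the
  other cones disappear; this does not decrease the dimensions.  Conversely, the generators lie below
  \<open>g\<close>, so an exponent \<open>e\<close> belongs to \<open>I - J\<close> if and only if \<open>inf e g\<close> lies in the characteristic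
  poset, and the interval containing \<open>inf e g\<close> determines the cone containing \<open>e\<close>.
\<close>

section \<open>Monomial ideals and their quotients\<close>

text \<open>The exponents of the monomials in the ideal generated by the \<open>xpow a\<close> with
  \<open>a\<close> in \<open>A\<close>.\<close>

definition up_set :: "('n \<Rightarrow> nat) set \<Rightarrow> ('n \<Rightarrow> nat) set" where
  "up_set A = {c. \<exists>a\<in>A. a \<le> c}"

lemma up_set_add: "e \<in> up_set A \<Longrightarrow> e + z \<in> up_set A"
  by (auto simp: up_set_def le_fun_def intro!: trans_le_add1)

text \<open>The exponents of the monomials in \<open>xpow a\<close> times K[Z]. Inequalities make
  membership a pointwise check; the translate form is \<open>cone_eq_image\<close>.\<close>

definition cone :: "('n \<Rightarrow> nat) \<Rightarrow> 'n set \<Rightarrow> ('n \<Rightarrow> nat) set" where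
  "cone a Z = {e. a \<le> e \<and> (\<forall>j. j \<notin> Z \<longrightarrow> e j = a j)}"

lemma self_in_cone [simp]: "a \<in> cone a Z"
  by (simp add: cone_def)

lemma cone_eq_image: "cone a Z = (\<lambda>z. z + a) ` exponents_in Z"
proof (intro equalityI subsetI)
  fix e assume e: "e \<in> cone a Z"
  then have "e = (e - a) + a"
    by (auto simp: cone_def le_fun_def fun_eq_iff)
  moreover have "e - a \<in> exponents_in Z"
    using e by (auto simp: cone_def exponents_in_def)
  ultimately show "e \<in> (\<lambda>z. z + a) ` exponents_in Z" by (rule image_eqI)
qed (auto simp: cone_def le_fun_def exponents_in_def)

section \<open>Coefficients and supports of polynomials\<close>

definition restrict_poly :: "'a set \<Rightarrow> ('a \<Rightarrow>\<^sub>0 'b::zero) \<Rightarrow> ('a \<Rightarrow>\<^sub>0 'b)" where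
  "restrict_poly C = Poly_Mapping.mapp (\<lambda>k v. v when k \<in> C)"

lemma lookup_restrict_poly:
  "Poly_Mapping.lookup (restrict_poly C f) e = (Poly_Mapping.lookup f e when e \<in> C)"
  by (auto simp: restrict_poly_def lookup_mapp when_def in_keys_iff)

lemma keys_restrict_poly: "Poly_Mapping.keys (restrict_poly C f) = Poly_Mapping.keys f \<inter> C"
  by (auto simp: in_keys_iff lookup_restrict_poly)

lemma poly_eq_sum_single:
  "f = (\<Sum>k\<in>Poly_Mapping.keys f. Poly_Mapping.single k (Poly_Mapping.lookup f k))"
  by (rule poly_mapping_eqI)
    (auto simp: lookup_sum lookup_single when_def sum.If_cases in_keys_iff sum.delta' if_distrib
      intro!: sum.neutral cong: if_cong)

text \<open>Translation of exponents by \<open>a\<close> is injective by cancellation, so only the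
  term of \<open>p\<close> at \<open>k\<close> contributes at \<open>k + a\<close>.\<close>

lemma lookup_times_single:
  fixes p :: "'a::cancel_comm_monoid_add \<Rightarrow>\<^sub>0 'b::comm_semiring_0"
  shows "Poly_Mapping.lookup (p * Poly_Mapping.single a c) (k + a) = Poly_Mapping.lookup p k * c"
proof -
  have "p * Poly_Mapping.single a c =
      (\<Sum>l\<in>Poly_Mapping.keys p. Poly_Mapping.single (l + a) (Poly_Mapping.lookup p l * c))"
    by (subst poly_eq_sum_single) (simp add: sum_distrib_right mult_single)
  then show ?thesis
    by (auto simp: lookup_sum lookup_single when_def in_keys_iff)
qed

lemma keys_const_mult:
  fixes f :: "('n, 'k::field) mpoly"
  shows "Poly_Mapping.keys (const_mpoly c * f) \<subseteq> Poly_Mapping.keys f"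
  using keys_mult[of "const_mpoly c" f] by (auto simp: const_mpoly_def split: if_splits)

section \<open>Monomial ideals described by supports\<close>

lemma ring_mpoly_ring: "ring (mpoly_ring :: ('n, 'k::field) mpoly ring)"
  by (rule ring_from_type_algebra)

lemma mpoly_ring_simps [simp]:
  "carrier (mpoly_ring :: ('n, 'k::field) mpoly ring) = UNIV"
  "p \<oplus>\<^bsub>mpoly_ring\<^esub> q = p + q" "p \<otimes>\<^bsub>mpoly_ring\<^esub> q = p * q"
  "\<zero>\<^bsub>mpoly_ring\<^esub> = (0 :: ('n, 'k::field) mpoly)" "\<one>\<^bsub>mpoly_ring\<^esub> = (1 :: ('n, 'k::field) mpoly)"
  for p q :: "('n, 'k::field) mpoly"
  by (simp_all add: ring_of_type_algebra_def)

lemma mpoly_ring_uminus [simp]: "\<ominus>\<^bsub>mpoly_ring\<^esub> p = - p" for p :: "('n, 'k::field) mpoly"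
proof -
  interpret ring "mpoly_ring :: ('n, 'k::field) mpoly ring" by (rule ring_mpoly_ring)
  show ?thesis by (rule minus_equality) auto
qed

lemma ideal_up_set: "ideal {f :: ('n, 'k::field) mpoly. Poly_Mapping.keys f \<subseteq> up_set A} mpoly_ring"
  (is "ideal ?U _")
proof -
  interpret ring "mpoly_ring :: ('n, 'k::field) mpoly ring" by (rule ring_mpoly_ring)
  have mult: "p * f \<in> ?U" if f: "f \<in> ?U" for p f :: "('n, 'k) mpoly"
  proof -
    have "Poly_Mapping.keys (f * p) \<subseteq> up_set A"
      using keys_mult[of f p] f up_set_add by blast
    then show ?thesis by (simp add: mult.commute)
  qed
  show ?thesis
  proof (rule idealI)
    show "subgroup ?U (add_monoid mpoly_ring)"
    proof (rule add.subgroupI)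
      show "\<ominus>\<^bsub>mpoly_ring\<^esub> f \<in> ?U" if "f \<in> ?U" for f :: "('n, 'k) mpoly"
        using that by (simp add: in_keys_iff subset_iff)
    next
      show "f \<oplus>\<^bsub>mpoly_ring\<^esub> h \<in> ?U" if "f \<in> ?U" "h \<in> ?U" for f h :: "('n, 'k) mpoly"
        using that Poly_Mapping.keys_add[of f h] by auto
    qed (auto intro: exI[of _ 0])
  qed (use mult in \<open>auto simp: ring_axioms mult.commute\<close>)
qed

text \<open>The polynomials supported on \<open>up_set A\<close> form an ideal containing the
  generators. Conversely, each of their terms is a multiple of some \<open>xpow a\<close> with
  \<open>a\<close> in \<open>A\<close>.\<close>

lemma monomial_ideal_eq:
  "monomial_ideal A = {f :: ('n, 'k::field) mpoly. Poly_Mapping.keys f \<subseteq> up_set A}"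
proof
  interpret ring "mpoly_ring :: ('n, 'k) mpoly ring" by (rule ring_mpoly_ring)
  show "monomial_ideal A \<subseteq> {f :: ('n, 'k) mpoly. Poly_Mapping.keys f \<subseteq> up_set A}"
    unfolding monomial_ideal_def
    by (rule genideal_minimal[OF ideal_up_set]) (auto simp: xpow_def up_set_def)
  have ideal: "ideal (monomial_ideal A :: ('n, 'k) mpoly set) mpoly_ring"
    unfolding monomial_ideal_def by (rule genideal_ideal) simp
  then interpret I: ideal "monomial_ideal A :: ('n, 'k) mpoly set" mpoly_ring .
  have gen: "xpow a \<in> (monomial_ideal A :: ('n, 'k) mpoly set)" if "a \<in> A" for a
    using genideal_self[of "xpow ` A"] that unfolding monomial_ideal_def by auto
  have sng: "Poly_Mapping.single e c \<in> (monomial_ideal A :: ('n, 'k) mpoly set)"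
    if "e \<in> up_set A" for e c
  proof -
    from that obtain a where a: "a \<in> A" "a \<le> e" by (auto simp: up_set_def)
    then have "e = (e - a) + a" by (auto simp: fun_eq_iff le_fun_def)
    then have "Poly_Mapping.single e c = Poly_Mapping.single (e - a) c * xpow a"
      by (simp add: xpow_def mult_single)
    then show ?thesis using I.I_l_closed[OF gen[OF a(1)]] by simp
  qed
  have sums: "sum h T \<in> monomial_ideal A" if "finite T" "\<And>t. t \<in> T \<Longrightarrow> h t \<in> monomial_ideal A"
    for T :: "('n \<Rightarrow> nat) set" and h :: "_ \<Rightarrow> ('n, 'k) mpoly"
    using that
  proof (induction T rule: finite_induct)
    case empty
    then show ?case using I.zero_closed by simp
  next
    case (insert t T)
    then show ?case using I.a_closed[of "h t" "sum h T"] by simp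
  qed
  show "{f :: ('n, 'k) mpoly. Poly_Mapping.keys f \<subseteq> up_set A} \<subseteq> monomial_ideal A"
  proof
    fix f :: "('n, 'k) mpoly" assume "f \<in> {f. Poly_Mapping.keys f \<subseteq> up_set A}"
    then show "f \<in> monomial_ideal A"
      by (subst poly_eq_sum_single) (auto intro!: sums sng)
  qed
qed

section \<open>The quotient I/J and coordinates of its elements\<close>

locale monomial_quotient =
  fixes A B :: "('n::finite \<Rightarrow> nat) set" and I J :: "('n, 'k::field) mpoly set"
  assumes I_eq: "I = monomial_ideal A" and J_eq: "J = monomial_ideal B" and J_sub: "J \<subset> I"
begin

abbreviation M where "M \<equiv> quot_module I J"

abbreviation residue :: "('n, 'k) mpoly \<Rightarrow> ('n, 'k) mpoly set" where
  "residue f \<equiv> J +>\<^bsub>mpoly_ring\<^esub> f"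

text \<open>The exponents of the monomial basis of \<open>I/J\<close>.\<close>

definition E where "E = up_set A - up_set B"

text \<open>For \<open>C\<close> inside \<open>up_set A\<close> this is the K-span of the classes of
  the monomials with exponent in \<open>C\<close>. Stating it through supports gives every element
  an explicit representative.\<close>

definition span_on :: "('n \<Rightarrow> nat) set \<Rightarrow> ('n, 'k) mpoly set set" where
  "span_on C = residue ` {f. Poly_Mapping.keys f \<subseteq> C}"

lemma I_iff: "f \<in> I \<longleftrightarrow> Poly_Mapping.keys f \<subseteq> up_set A"
  by (simp add: I_eq monomial_ideal_eq)

lemma J_iff: "f \<in> J \<longleftrightarrow> Poly_Mapping.keys f \<subseteq> up_set B"
  by (simp add: J_eq monomial_ideal_eq)

text \<open>Inclusion is tested on single monomials. Equality of the two exponent sets would force I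
  = J by \<open>monomial_ideal_eq\<close>.\<close>

lemma up_set_subset: "up_set B \<subset> up_set A"
proof -
  have "up_set B \<subseteq> up_set A"
  proof
    fix e assume "e \<in> up_set B"
    then have "xpow e \<in> J" by (simp add: J_iff xpow_def)
    then have "xpow e \<in> I" using J_sub by auto
    then show "e \<in> up_set A" by (simp add: I_iff xpow_def)
  qed
  moreover have "up_set B \<noteq> up_set A"
    using J_sub by (auto simp: I_eq J_eq monomial_ideal_eq)
  ultimately show ?thesis by blast
qed

lemma ideal_I: "ideal I mpoly_ring" and ideal_J: "ideal J mpoly_ring"
  unfolding I_eq J_eq monomial_ideal_eq by (rule ideal_up_set)+

sublocale R: ring "mpoly_ring :: ('n, 'k) mpoly ring" by (rule ring_mpoly_ring)
sublocale JR: ideal J mpoly_ring by (rule ideal_J)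
sublocale M: module mpoly_ring M by (rule quot_module_module[OF ideal_I ideal_J])

text \<open>The difference of two representatives must be supported on \<open>up_set B\<close>.
  Hence the coefficients outside \<open>up_set B\<close> are coordinates on residue classes.\<close>

lemma residue_eq_iff:
  "residue f = residue h \<longleftrightarrow>
    (\<forall>e. e \<notin> up_set B \<longrightarrow> Poly_Mapping.lookup f e = Poly_Mapping.lookup h e)"
proof -
  have "residue f = residue h \<longleftrightarrow> f \<ominus>\<^bsub>mpoly_ring\<^esub> h \<in> J"
    by (rule R.quotient_eq_iff_same_a_r_cos[symmetric, OF ideal_J]) simp_all
  also have "\<dots> \<longleftrightarrow> f - h \<in> J" by (simp add: a_minus_def)
  also have "\<dots> \<longleftrightarrow> (\<forall>e. e \<notin> up_set B \<longrightarrow> Poly_Mapping.lookup f e = Poly_Mapping.lookup h e)"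
    by (auto simp: J_iff subset_iff in_keys_iff lookup_minus)
  finally show ?thesis .
qed

lemma carrier_M: "carrier M = residue ` I"
  by (simp add: quot_module_def)

lemma zero_M: "\<zero>\<^bsub>M\<^esub> = residue 0"
  using R.a_rcos_zero[OF ideal_J JR.zero_closed] by (simp add: quot_module_def)

lemma add_M: "residue f \<oplus>\<^bsub>M\<^esub> residue h = residue (f + h)"
  using JR.a_rcos_sum[of f h] by (simp add: quot_module_def)

lemma smult_M: "p \<odot>\<^bsub>M\<^esub> residue h = residue (p * h)"
  using JR.rcoset_mult_add[of p h] by (simp add: quot_module_def)

lemma residue_eq_zero_iff: "residue f = \<zero>\<^bsub>M\<^esub> \<longleftrightarrow> f \<in> J"
  unfolding zero_M residue_eq_iff by (auto simp: J_iff subset_iff in_keys_iff)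

lemma finsum_residue:
  assumes "finite T" and "\<And>i. i \<in> T \<Longrightarrow> h i \<in> I"
  shows "(\<Oplus>\<^bsub>M\<^esub>i\<in>T. residue (h i)) = residue (\<Sum>i\<in>T. h i)"
  using assms
proof (induction T rule: finite_induct)
  case empty
  then show ?case by (simp add: zero_M)
next
  case (insert i T)
  then have "(\<lambda>i. residue (h i)) \<in> T \<rightarrow> carrier M" "residue (h i) \<in> carrier M"
    by (auto simp: carrier_M)
  with insert show ?case by (simp add: M.finsum_insert add_M)
qed


section \<open>Subspaces of I/J spanned by monomials\<close>

lemma span_on_memI: "Poly_Mapping.keys f \<subseteq> C \<Longrightarrow> residue f \<in> span_on C"
  by (auto simp: span_on_def)

lemma span_on_memE:
  assumes "x \<in> span_on C"
  obtains f where "x = residue f" "Poly_Mapping.keys f \<subseteq> C"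
  using assms by (auto simp: span_on_def)

lemma K_subspace_span_on:
  assumes "C \<subseteq> up_set A"
  shows "K_subspace M (span_on C)"
  unfolding K_subspace_def
proof (intro conjI ballI allI)
  show "span_on C \<subseteq> carrier M"
    using assms by (auto simp: span_on_def carrier_M I_iff)
  show "\<zero>\<^bsub>M\<^esub> \<in> span_on C"
    unfolding zero_M by (rule span_on_memI) simp
  show "x \<oplus>\<^bsub>M\<^esub> y \<in> span_on C" if xy: "x \<in> span_on C" "y \<in> span_on C" for x y
  proof -
    obtain f h where *: "x = residue f" "Poly_Mapping.keys f \<subseteq> C"
      "y = residue h" "Poly_Mapping.keys h \<subseteq> C"
      using xy by (auto elim!: span_on_memE)
    then have "Poly_Mapping.keys (f + h) \<subseteq> C" using Poly_Mapping.keys_add[of f h] by auto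
    then show ?thesis unfolding * add_M by (rule span_on_memI)
  qed
  show "const_mpoly c \<odot>\<^bsub>M\<^esub> x \<in> span_on C" if x: "x \<in> span_on C" for c x
  proof -
    obtain f where *: "x = residue f" "Poly_Mapping.keys f \<subseteq> C"
      using x by (auto elim!: span_on_memE)
    then have "Poly_Mapping.keys (const_mpoly c * f) \<subseteq> C" using keys_const_mult[of c f] by auto
    then show ?thesis unfolding * smult_M by (rule span_on_memI)
  qed
qed

text \<open>A subspace containing these generators contains all terms with exponent in
  \<open>S\<close>, because \<open>c\<close> can be divided out, and hence all their sums. The
  scalar \<open>c\<close> is allowed because a homogeneous generator is a monomial only up to a
  scalar.\<close>

lemma K_span_singles:
  assumes S: "S \<subseteq> up_set A" and c: "c \<noteq> 0"
  shows "K_span M ((\<lambda>e. residue (Poly_Mapping.single e c)) ` S) = span_on S"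
proof (rule equalityI)
  show "K_span M ((\<lambda>e. residue (Poly_Mapping.single e c)) ` S) \<subseteq> span_on S"
    unfolding K_span_def
    by (rule Inter_lower) (use c in \<open>auto intro!: K_subspace_span_on S span_on_memI\<close>)
  show "span_on S \<subseteq> K_span M ((\<lambda>e. residue (Poly_Mapping.single e c)) ` S)"
    unfolding K_span_def
  proof (intro subsetI InterI)
    fix x U assume x: "x \<in> span_on S"
      and "U \<in> {U. K_subspace M U \<and> (\<lambda>e. residue (Poly_Mapping.single e c)) ` S \<subseteq> U}"
    then have U: "K_subspace M U" "\<And>e. e \<in> S \<Longrightarrow> residue (Poly_Mapping.single e c) \<in> U"
      by auto
    obtain f where f: "x = residue f" "Poly_Mapping.keys f \<subseteq> S"
      using x by (auto elim!: span_on_memE)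
    have mono: "residue (Poly_Mapping.single e v) \<in> U" if "e \<in> S" for e v
    proof -
      have "const_mpoly (v / c) * Poly_Mapping.single e c = Poly_Mapping.single e v"
        using c by (simp add: const_mpoly_def mult_single)
      moreover have "const_mpoly (v / c) \<odot>\<^bsub>M\<^esub> residue (Poly_Mapping.single e c) \<in> U"
        using U that by (simp add: K_subspace_def)
      ultimately show ?thesis by (simp add: smult_M)
    qed
    have "residue (\<Sum>k\<in>T. Poly_Mapping.single k (Poly_Mapping.lookup f k)) \<in> U"
      if "finite T" "T \<subseteq> S" for T
      using that
    proof (induction T rule: finite_induct)
      case empty
      then show ?case using U(1) by (simp add: K_subspace_def zero_M)
    next
      case (insert k T)
      then show ?case using U(1) mono[of k] by (simp add: K_subspace_def flip: add_M)
    qed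
    from this[OF finite_keys f(2)] show "x \<in> U"
      unfolding f(1) by (simp flip: poly_eq_sum_single)
  qed
qed

section \<open>Stanley spaces and direct sums as sets of exponents\<close>

lemma stanley_span_single:
  assumes "cone a Z \<subseteq> up_set A" and "c \<noteq> 0"
  shows "stanley_span M (residue (Poly_Mapping.single a c)) Z = span_on (cone a Z)"
proof -
  have "(\<lambda>z. xpow z \<odot>\<^bsub>M\<^esub> residue (Poly_Mapping.single a c)) ` exponents_in Z
      = (\<lambda>e. residue (Poly_Mapping.single e c)) ` cone a Z"
    by (simp add: smult_M xpow_def mult_single cone_eq_image image_image)
  then show ?thesis
    unfolding stanley_span_def using K_span_singles[OF assms] by simp
qed

lemma cone_subset_up_set: "a \<in> up_set A \<Longrightarrow> cone a Z \<subseteq> up_set A"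
  by (auto simp: up_set_def cone_def intro: order_trans)

text \<open>A multidegree determines the exponent, so a nonzero homogeneous polynomial is a single
  term. Multiplying this term by an element of K[Z] only shifts exponents and scales coefficients,
  so freeness means that no shift of \<open>a\<close> along \<open>Z\<close> falls into
  \<open>up_set B\<close>.\<close>

lemma stanley_space_iff:
  "stanley_space M (quot_component I J) u Z \<longleftrightarrow>
    (\<exists>a c. c \<noteq> 0 \<and> u = residue (Poly_Mapping.single a c) \<and> cone a Z \<subseteq> E)"
proof
  assume sp: "stanley_space M (quot_component I J) u Z"
  then have free: "p = 0" if "p \<in> polys_in Z" "p \<odot>\<^bsub>M\<^esub> u = \<zero>\<^bsub>M\<^esub>" for p
    using that by (auto simp: stanley_space_def)
  obtain f \<delta> where f: "f \<in> I" "homogeneous_poly \<delta> f" "u = residue f"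
    using sp by (auto simp: stanley_space_def quot_component_def)
  have "f \<noteq> 0"
  proof
    assume "f = 0"
    \<comment> \<open>The polynomial \<open>1\<close> lies in K[Z] and would annihilate the zero
      class.\<close>
    then have "(1 :: ('n, 'k) mpoly) = 0"
      by (intro free) (auto simp: polys_in_def exponents_in_def f smult_M zero_M)
    then show False by simp
  qed
  then obtain a where a: "a \<in> Poly_Mapping.keys f"
    by (metis all_not_in_conv keys_eq_empty)
  have "b = a" if "b \<in> Poly_Mapping.keys f" for b
  proof -
    have "(\<lambda>j. int (b j)) = (\<lambda>j. int (a j))"
      using f(2) a that by (simp add: homogeneous_poly_def)
    then show ?thesis by (simp add: fun_eq_iff)
  qed
  then have keys_f: "Poly_Mapping.keys f = {a}" using a by blast
  have fs: "f = Poly_Mapping.single a (Poly_Mapping.lookup f a)"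
    by (subst poly_eq_sum_single) (simp add: keys_f)
  define c where "c = Poly_Mapping.lookup f a"
  have c: "c \<noteq> 0" using a by (simp add: c_def in_keys_iff)
  have u: "u = residue (Poly_Mapping.single a c)" using f(3) fs by (simp add: c_def)
  have "cone a Z \<inter> up_set B = {}"
  proof (rule ccontr)
    assume "cone a Z \<inter> up_set B \<noteq> {}"
    then obtain z where z: "z \<in> exponents_in Z" "z + a \<in> up_set B"
      by (auto simp: cone_eq_image)
    \<comment> \<open>A monomial of K[Z] that moves \<open>a\<close> into \<open>up_set B\<close>
      annihilates \<open>u\<close>.\<close>
    have "xpow z * Poly_Mapping.single a c \<in> J"
      using z(2) by (simp add: xpow_def mult_single J_iff)
    then have "(xpow z :: ('n, 'k) mpoly) = 0"
      using z(1) by (intro free) (auto simp: u smult_M residue_eq_zero_iff polys_in_def xpow_def)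
    then have "Poly_Mapping.keys (xpow z :: ('n, 'k) mpoly) = {}" by simp
    then show False by (simp add: xpow_def)
  qed
  moreover have "cone a Z \<subseteq> up_set A"
    using a f(1) by (intro cone_subset_up_set) (auto simp: I_iff)
  ultimately show "\<exists>a c. c \<noteq> 0 \<and> u = residue (Poly_Mapping.single a c) \<and> cone a Z \<subseteq> E"
    using c u by (auto simp: E_def)
next
  assume "\<exists>a c. c \<noteq> 0 \<and> u = residue (Poly_Mapping.single a c) \<and> cone a Z \<subseteq> E"
  then obtain a c where c: "c \<noteq> 0" and u: "u = residue (Poly_Mapping.single a c)"
    and sub: "cone a Z \<subseteq> E" by blast
  have aI: "Poly_Mapping.single a c \<in> I"
    using sub self_in_cone[of a Z] c unfolding E_def by (auto simp: I_iff simp del: self_in_cone)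
  have hom: "homogeneous_poly (\<lambda>j. int (a j)) (Poly_Mapping.single a c)"
    by (simp add: homogeneous_poly_def)
  show "stanley_space M (quot_component I J) u Z"
    unfolding stanley_space_def
  proof (intro conjI ballI impI)
    show "u \<in> carrier M" using aI by (auto simp: u carrier_M)
    show "\<exists>\<delta>. u \<in> quot_component I J \<delta>"
      unfolding u quot_component_def using aI hom by blast
    fix p :: "('n, 'k) mpoly" assume p: "p \<in> polys_in Z" "p \<odot>\<^bsub>M\<^esub> u = \<zero>\<^bsub>M\<^esub>"
    have pJ: "Poly_Mapping.keys (p * Poly_Mapping.single a c) \<subseteq> up_set B"
      using p(2) by (simp add: u smult_M residue_eq_zero_iff J_iff)
    \<comment> \<open>The shift by \<open>a\<close> keeps nonzero coefficients nonzero, so an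
      exponent of \<open>p\<close> would be carried into both the cone and
      \<open>up_set B\<close>.\<close>
    have "k \<notin> Poly_Mapping.keys p" for k
    proof
      assume k: "k \<in> Poly_Mapping.keys p"
      then have "k + a \<in> up_set B"
        using pJ c by (auto simp: in_keys_iff lookup_times_single subset_iff)
      moreover have "k + a \<in> cone a Z"
        using k p(1) by (auto simp: cone_eq_image polys_in_def)
      ultimately show False using sub by (auto simp: E_def)
    qed
    then show "p = 0" by (metis all_not_in_conv keys_eq_empty)
  qed
qed

text \<open>The classes of the monomials with exponent in \<open>E\<close> form a K-basis of I/J.
  Subspaces spanned by parts of a basis give a direct sum decomposition exactly when the parts
  partition the basis.\<close>

lemma internal_direct_sum_span_on:
  assumes T: "finite T" and sub: "\<And>i. i \<in> T \<Longrightarrow> C i \<subseteq> E"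
  shows "internal_direct_sum M T (\<lambda>i. span_on (C i)) \<longleftrightarrow>
    disjoint_family_on C T \<and> (\<Union>i\<in>T. C i) = E"
proof -
  have subA: "C i \<subseteq> up_set A" and notB: "e \<in> C i \<Longrightarrow> e \<notin> up_set B" if "i \<in> T" for i e
    using sub[OF that] by (auto simp: E_def)
  have lookup0: "Poly_Mapping.lookup h e = 0" if "Poly_Mapping.keys h \<subseteq> S" "e \<notin> S"
    for h :: "('n, 'k) mpoly" and S e
    using that by (auto simp: in_keys_iff subset_iff)
  have in_I: "h \<in> I" if "i \<in> T" "Poly_Mapping.keys h \<subseteq> C i" for h i
    using that subA by (auto simp: I_iff)
  \<comment> \<open>Representatives supported on the \<open>C i\<close> turn sums in the module into
    sums of polynomials.\<close>
  have reps: "\<exists>h. (\<forall>i\<in>T. w i = residue (h i) \<and> Poly_Mapping.keys (h i) \<subseteq> C i) \<and>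
      (\<Oplus>\<^bsub>M\<^esub>i\<in>T. w i) = residue (\<Sum>i\<in>T. h i)" if w: "w \<in> (\<Pi>\<^sub>E i\<in>T. span_on (C i))" for w
  proof -
    have "\<forall>i\<in>T. \<exists>h. w i = residue h \<and> Poly_Mapping.keys h \<subseteq> C i"
      using w by (fastforce simp: span_on_def)
    then obtain h where h: "\<forall>i\<in>T. w i = residue (h i) \<and> Poly_Mapping.keys (h i) \<subseteq> C i"
      by metis
    have "(\<Oplus>\<^bsub>M\<^esub>i\<in>T. w i) = (\<Oplus>\<^bsub>M\<^esub>i\<in>T. residue (h i))"
      using h in_I by (intro M.finsum_cong') (auto simp: carrier_M)
    also have "\<dots> = residue (\<Sum>i\<in>T. h i)"
      using h in_I by (intro finsum_residue T) auto
    finally show ?thesis using h by blast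
  qed
  show ?thesis
  proof
    assume ds: "internal_direct_sum M T (\<lambda>i. span_on (C i))"
    have ex1: "\<exists>!w. w \<in> (\<Pi>\<^sub>E i\<in>T. span_on (C i)) \<and> x = (\<Oplus>\<^bsub>M\<^esub>i\<in>T. w i)"
      if "x \<in> carrier M" for x
      using ds that by (simp add: internal_direct_sum_def)
    have xcar: "residue (xpow e) \<in> carrier M" if "e \<in> E" for e
      using that by (auto simp: carrier_M I_iff E_def xpow_def)
    have "disjoint_family_on C T"
      unfolding disjoint_family_on_def
    proof (intro ballI impI, rule ccontr)
      fix i j assume ij: "i \<in> T" "j \<in> T" "i \<noteq> j" and "C i \<inter> C j \<noteq> {}"
      then obtain e where e: "e \<in> C i" "e \<in> C j" by blast
      define x where "x = residue (xpow e)"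
      \<comment> \<open>Placing the class of \<open>xpow e\<close> in component \<open>i\<close> or
        in component \<open>j\<close> gives two decompositions of the same element, against
        uniqueness.\<close>
      define v where "v k = (\<lambda>l\<in>T. residue (if l = k then xpow e else 0))" for k
      have v: "v k \<in> (\<Pi>\<^sub>E i\<in>T. span_on (C i)) \<and> x = (\<Oplus>\<^bsub>M\<^esub>l\<in>T. v k l)"
        if k: "k \<in> T" "e \<in> C k" for k
      proof
        show "v k \<in> (\<Pi>\<^sub>E i\<in>T. span_on (C i))"
          using k by (auto simp: v_def xpow_def intro!: span_on_memI split: if_splits)
        have inI: "(if l = k then xpow e else 0) \<in> I" for l
          using k subA by (auto simp: I_iff xpow_def)
        have "(\<Oplus>\<^bsub>M\<^esub>l\<in>T. v k l) = (\<Oplus>\<^bsub>M\<^esub>l\<in>T. residue (if l = k then xpow e else 0))"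
          using inI by (intro M.finsum_cong') (auto simp: carrier_M v_def)
        also have "\<dots> = residue (\<Sum>l\<in>T. if l = k then xpow e else 0)"
          by (rule finsum_residue[OF T inI])
        also have "\<dots> = x" using T k by (simp add: x_def)
        finally show "x = (\<Oplus>\<^bsub>M\<^esub>l\<in>T. v k l)" by simp
      qed
      have "x \<in> carrier M" unfolding x_def using e(1) ij(1) sub by (intro xcar) auto
      then have "v i = v j" using ex1 v[OF ij(1) e(1)] v[OF ij(2) e(2)] by blast
      then have "v i i = v j i" by simp
      then have "x = \<zero>\<^bsub>M\<^esub>" using ij by (simp add: v_def x_def zero_M)
      then show False
        using notB[OF ij(1) e(1)] by (simp add: x_def residue_eq_zero_iff J_iff xpow_def)
    qed
    moreover have "E \<subseteq> (\<Union>i\<in>T. C i)"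
    proof
      fix e assume e: "e \<in> E"
      obtain w where w: "w \<in> (\<Pi>\<^sub>E i\<in>T. span_on (C i))" "residue (xpow e) = (\<Oplus>\<^bsub>M\<^esub>i\<in>T. w i)"
        using ex1[OF xcar[OF e]] by blast
      obtain h where h: "\<forall>i\<in>T. w i = residue (h i) \<and> Poly_Mapping.keys (h i) \<subseteq> C i"
        "(\<Oplus>\<^bsub>M\<^esub>i\<in>T. w i) = residue (\<Sum>i\<in>T. h i)"
        using reps[OF w(1)] by blast
      \<comment> \<open>As \<open>e\<close> is outside \<open>up_set B\<close>, coefficients at
        \<open>e\<close> can be compared; some summand must then have \<open>e\<close> in its
        support.\<close>
      have "(\<Sum>i\<in>T. Poly_Mapping.lookup (h i) e) = 1"
        using w(2) e unfolding h(2) residue_eq_iff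
        by (auto simp: E_def lookup_sum xpow_def)
      then obtain i where "i \<in> T" "Poly_Mapping.lookup (h i) e \<noteq> 0"
        using sum.not_neutral_contains_not_neutral[of "\<lambda>i. Poly_Mapping.lookup (h i) e" T] by auto
      then show "e \<in> (\<Union>i\<in>T. C i)" using h(1) by (auto simp: in_keys_iff subset_iff)
    qed
    ultimately show "disjoint_family_on C T \<and> (\<Union>i\<in>T. C i) = E" using sub by blast
  next
    assume "disjoint_family_on C T \<and> (\<Union>i\<in>T. C i) = E"
    then have disj: "\<And>i j e. i \<in> T \<Longrightarrow> j \<in> T \<Longrightarrow> e \<in> C i \<Longrightarrow> e \<in> C j \<Longrightarrow> j = i"
      and cover: "(\<Union>i\<in>T. C i) = E" by (auto simp: disjoint_family_on_def)
    show "internal_direct_sum M T (\<lambda>i. span_on (C i))"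
      unfolding internal_direct_sum_def
    proof (intro conjI ballI)
      show "K_subspace M (span_on (C i))" if "i \<in> T" for i
        using subA[OF that] by (rule K_subspace_span_on)
      fix x assume "x \<in> carrier M"
      then obtain f where f: "f \<in> I" "x = residue f" by (auto simp: carrier_M)
      \<comment> \<open>The components are found by cutting \<open>f\<close> down to the terms with
        exponent in \<open>C i\<close>.\<close>
      define w where "w = (\<lambda>i\<in>T. residue (restrict_poly (C i) f))"
      show "\<exists>!w. w \<in> (\<Pi>\<^sub>E i\<in>T. span_on (C i)) \<and> x = (\<Oplus>\<^bsub>M\<^esub>i\<in>T. w i)"
      proof (rule ex1I[of _ w], rule conjI)
        show "w \<in> (\<Pi>\<^sub>E i\<in>T. span_on (C i))"
          by (auto simp: w_def keys_restrict_poly intro!: span_on_memI)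
        have inI: "restrict_poly (C i) f \<in> I" for i
          using f(1) by (auto simp: I_iff keys_restrict_poly)
        have "(\<Oplus>\<^bsub>M\<^esub>i\<in>T. w i) = (\<Oplus>\<^bsub>M\<^esub>i\<in>T. residue (restrict_poly (C i) f))"
          using inI by (intro M.finsum_cong') (auto simp: carrier_M w_def)
        also have "\<dots> = residue (\<Sum>i\<in>T. restrict_poly (C i) f)"
          by (rule finsum_residue[OF T inI])
        also have "\<dots> = x"
          unfolding f(2) residue_eq_iff
        proof (intro allI impI)
          fix e assume e: "e \<notin> up_set B"
          show "Poly_Mapping.lookup (\<Sum>i\<in>T. restrict_poly (C i) f) e = Poly_Mapping.lookup f e"
          proof (cases "e \<in> E")
            case True
            then obtain i where i: "i \<in> T" "e \<in> C i" using cover by blast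
            have "e \<in> C j \<longleftrightarrow> j = i" if "j \<in> T" for j
              using disj[OF i(1) that i(2)] i by blast
            then have "(\<Sum>j\<in>T. Poly_Mapping.lookup f e when e \<in> C j)
                = (\<Sum>j\<in>T. if j = i then Poly_Mapping.lookup f e else 0)"
              by (intro sum.cong) auto
            then show ?thesis using i T by (simp add: lookup_sum lookup_restrict_poly)
          next
            case False
            then have "Poly_Mapping.lookup f e = 0"
              using e f(1) by (intro lookup0[of _ "up_set A"]) (auto simp: E_def I_iff)
            then show ?thesis by (simp add: lookup_sum lookup_restrict_poly)
          qed
        qed
        finally show "x = (\<Oplus>\<^bsub>M\<^esub>i\<in>T. w i)" by simp
      next
        fix w' assume w': "w' \<in> (\<Pi>\<^sub>E i\<in>T. span_on (C i)) \<and> x = (\<Oplus>\<^bsub>M\<^esub>i\<in>T. w' i)"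
        then obtain h where h: "\<forall>i\<in>T. w' i = residue (h i) \<and> Poly_Mapping.keys (h i) \<subseteq> C i"
          "(\<Oplus>\<^bsub>M\<^esub>i\<in>T. w' i) = residue (\<Sum>i\<in>T. h i)"
          using reps by blast
        \<comment> \<open>For uniqueness: if \<open>e\<close> lies in \<open>C i\<close>,
          disjointness leaves only the summand of \<open>h i\<close>, which therefore has the same
          coefficient at \<open>e\<close> as \<open>f\<close>.\<close>
        have eq: "Poly_Mapping.lookup f e = (\<Sum>i\<in>T. Poly_Mapping.lookup (h i) e)"
          if "e \<notin> up_set B" for e
          using w' that f(2) unfolding h(2) by (auto simp: residue_eq_iff lookup_sum)
        have "w' i = w i" if i: "i \<in> T" for i
        proof -
          have "residue (h i) = residue (restrict_poly (C i) f)"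
            unfolding residue_eq_iff
          proof (intro allI impI)
            fix e assume e: "e \<notin> up_set B"
            show "Poly_Mapping.lookup (h i) e = Poly_Mapping.lookup (restrict_poly (C i) f) e"
            proof (cases "e \<in> C i")
              case True
              have "(\<Sum>j\<in>T. Poly_Mapping.lookup (h j) e)
                  = (\<Sum>j\<in>T. if j = i then Poly_Mapping.lookup (h i) e else 0)"
              proof (rule sum.cong)
                fix j assume j: "j \<in> T"
                then have "j \<noteq> i \<Longrightarrow> e \<notin> C j" using disj[OF i j True] by blast
                then show "Poly_Mapping.lookup (h j) e
                    = (if j = i then Poly_Mapping.lookup (h i) e else 0)"
                  using h(1) j lookup0 by auto
              qed simp
              then show ?thesis using True eq[OF e] i T by (simp add: lookup_restrict_poly)
            next
              case False
              then show ?thesis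
                using h(1) i lookup0[of "h i" "C i" e] by (simp add: lookup_restrict_poly)
            qed
          qed
          then show ?thesis using h(1) i by (simp add: w_def)
        qed
        \<comment> \<open>Both families are \<open>undefined\<close> outside \<open>T\<close>, so
          agreement on \<open>T\<close> suffices.\<close>
        then show "w' = w" using w' by (intro PiE_ext[of w' T]) (auto simp: w_def extensional_def PiE_def)
      qed
    qed
  qed
qed


section \<open>Stanley decompositions as partitions into cones\<close>

lemma internal_direct_sum_cong:
  assumes "\<And>i. i \<in> T \<Longrightarrow> W i = W' i"
  shows "internal_direct_sum M T W \<longleftrightarrow> internal_direct_sum M T W'"
  using assms PiE_cong[of T W W'] by (simp add: internal_direct_sum_def)

text \<open>The function \<open>m\<close> picks the exponent of each generator. The cones stay
  indexed by \<open>D\<close> with directions \<open>snd i\<close>, so their dimensions can be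
  compared with \<open>sdepth_decomp D\<close> directly.\<close>

lemma stanley_decomposition_imp_cones:
  assumes "stanley_decomposition M (quot_component I J) D"
  shows "\<exists>m. disjoint_family_on (\<lambda>i. cone (m i) (snd i)) D \<and> (\<Union>i\<in>D. cone (m i) (snd i)) = E"
proof -
  have D: "finite D" "\<forall>(u, Z)\<in>D. stanley_space M (quot_component I J) u Z"
    "internal_direct_sum M D (\<lambda>(u, Z). stanley_span M u Z)"
    using assms by (auto simp: stanley_decomposition_def)
  have "\<forall>i\<in>D. \<exists>a c. c \<noteq> 0 \<and> fst i = residue (Poly_Mapping.single a c) \<and> cone a (snd i) \<subseteq> E"
    using D(2) by (auto simp: stanley_space_iff)
  then obtain m c where mc: "\<And>i. i \<in> D \<Longrightarrow>
      c i \<noteq> 0 \<and> fst i = residue (Poly_Mapping.single (m i) (c i)) \<and> cone (m i) (snd i) \<subseteq> E"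
    by metis
  have span: "stanley_span M (fst i) (snd i) = span_on (cone (m i) (snd i))" if "i \<in> D" for i
    using mc[OF that] by (auto simp: E_def intro!: stanley_span_single)
  have "internal_direct_sum M D (\<lambda>i. span_on (cone (m i) (snd i)))"
    using D(3) unfolding case_prod_unfold
    by (subst (asm) internal_direct_sum_cong[OF span]) assumption+
  then have "disjoint_family_on (\<lambda>i. cone (m i) (snd i)) D \<and> (\<Union>i\<in>D. cone (m i) (snd i)) = E"
    using mc by (subst (asm) internal_direct_sum_span_on[OF D(1)]) auto
  then show ?thesis by blast
qed

text \<open>This allows the exponent of a monomial generator to be recovered from its residue
  class.\<close>

lemma residue_xpow_inj: "inj_on (\<lambda>a. residue (xpow a)) E"
proof (rule inj_onI)
  fix a b assume "a \<in> E" "b \<in> E" "residue (xpow a) = residue (xpow b)"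
  then have "Poly_Mapping.lookup (xpow a :: ('n, 'k) mpoly) a = Poly_Mapping.lookup (xpow b) a"
    unfolding residue_eq_iff by (auto simp: E_def)
  then show "a = b" by (auto simp: xpow_def lookup_single when_def split: if_splits)
qed

lemma cones_imp_stanley_decomposition:
  assumes T: "finite T" and disj: "disjoint_family_on (\<lambda>(a, Z). cone a Z) T"
    and cover: "(\<Union>(a, Z)\<in>T. cone a Z) = E"
  shows "stanley_decomposition M (quot_component I J) ((\<lambda>(a, Z). (residue (xpow a), Z)) ` T)"
    (is "stanley_decomposition _ _ ?D")
proof -
  \<comment> \<open>The cones are indexed by exponents but the decomposition by residue classes;
    \<open>m\<close> translates back. It applies because each apex lies in its own cone, hence in
    \<open>E\<close>.\<close>
  define m where "m = inv_into E (\<lambda>a. residue (xpow a))"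
  have sub: "cone a Z \<subseteq> E" if "(a, Z) \<in> T" for a Z
    using cover that by blast
  have m: "m (residue (xpow a)) = a" if "(a, Z) \<in> T" for a Z
    using sub[OF that] self_in_cone[of a Z] unfolding m_def
    by (intro inv_into_f_f[OF residue_xpow_inj]) auto
  have cones: "disjoint_family_on (\<lambda>i. cone (m (fst i)) (snd i)) ?D \<and>
      (\<Union>i\<in>?D. cone (m (fst i)) (snd i)) = E"
  proof
    show "disjoint_family_on (\<lambda>i. cone (m (fst i)) (snd i)) ?D"
      unfolding disjoint_family_on_def
    proof (intro ballI impI)
      fix i i' assume "i \<in> ?D" "i' \<in> ?D" "i \<noteq> i'"
      then obtain a Z a' Z' where "(a, Z) \<in> T" "(a', Z') \<in> T" "(a, Z) \<noteq> (a', Z')"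
        and "i = (residue (xpow a), Z)" "i' = (residue (xpow a'), Z')" by auto
      then show "cone (m (fst i)) (snd i) \<inter> cone (m (fst i')) (snd i') = {}"
        using disjoint_family_onD[OF disj, of "(a, Z)" "(a', Z')"] m by simp
    qed
    show "(\<Union>i\<in>?D. cone (m (fst i)) (snd i)) = E"
      unfolding cover[symmetric] using m by (auto simp: case_prod_unfold)
  qed
  have spaces: "stanley_space M (quot_component I J) (residue (xpow a)) Z"
    and spans: "stanley_span M (residue (xpow a)) Z = span_on (cone a Z)" if "(a, Z) \<in> T" for a Z
  proof -
    show "stanley_space M (quot_component I J) (residue (xpow a)) Z"
      unfolding stanley_space_iff xpow_def using sub[OF that] zero_neq_one by metis
    show "stanley_span M (residue (xpow a)) Z = span_on (cone a Z)"
      unfolding xpow_def using sub[OF that] by (intro stanley_span_single) (auto simp: E_def)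
  qed
  have "internal_direct_sum M ?D (\<lambda>i. span_on (cone (m (fst i)) (snd i)))"
    using T sub m cones by (subst internal_direct_sum_span_on) auto
  then have "internal_direct_sum M ?D (\<lambda>(u, Z). stanley_span M u Z)"
    by (subst (asm) internal_direct_sum_cong[where W' = "\<lambda>(u, Z). stanley_span M u Z"])
      (auto simp: spans m)
  then show ?thesis
    using T spaces by (auto simp: stanley_decomposition_def)
qed

end


section \<open>Partitions of the characteristic poset\<close>

lemma finite_le_fun: "finite {c :: 'n::finite \<Rightarrow> nat. c \<le> g}"
proof -
  have "{c. c \<le> g} = (\<Pi>\<^sub>E j\<in>UNIV. {..g j})"
    by (auto simp: le_fun_def PiE_def)
  then show ?thesis by (simp add: finite_PiE)
qed

lemma finite_char_poset: "finite (char_poset A B g :: ('n::finite \<Rightarrow> nat) set)"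
  by (rule finite_subset[OF _ finite_le_fun[of g]]) (auto simp: char_poset_def)

lemma interval_partition_subset: "interval_partition P \<P> \<Longrightarrow> \<P> \<subseteq> P \<times> P"
  by (auto simp: interval_partition_def)

text \<open>It ensures that the maximum over all partitions is taken over a nonempty set.\<close>

lemma interval_partition_singletons: "interval_partition P ((\<lambda>c. (c, c)) ` P)"
  by (auto simp: interval_partition_def disjoint_family_on_def poset_interval_def)

text \<open>A generator below \<open>g\<close> lies below \<open>e\<close> if and only if it lies
  below \<open>inf e g\<close>.\<close>

lemma inf_in_char_poset_iff:
  assumes "\<forall>a\<in>A. a \<le> g" and "\<forall>b\<in>B. b \<le> g"
  shows "inf e g \<in> char_poset A B g \<longleftrightarrow> e \<in> up_set A - up_set B"
  using assms by (auto simp: char_poset_def up_set_def)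

text \<open>Inside the box below \<open>g\<close>, a cone with apex \<open>m i\<close> is free up to
  \<open>g\<close> on \<open>Z i\<close> and constant elsewhere, so it is an interval. Its two ends
  belong to the cone, hence to the poset.\<close>

lemma interval_partition_of_cones:
  assumes bounds: "\<forall>a\<in>A. a \<le> g" "\<forall>b\<in>B. b \<le> g"
    and disj: "disjoint_family_on (\<lambda>i. cone (m i) (Z i)) D"
    and cover: "(\<Union>i\<in>D. cone (m i) (Z i)) = up_set A - up_set B"
  shows "interval_partition (char_poset A B g)
    ((\<lambda>i. (m i, \<lambda>j. if j \<in> Z i then g j else m i j)) ` {i \<in> D. m i \<le> g})"
    (is "interval_partition ?P ((\<lambda>i. (m i, ?top i)) ` ?D)")
proof -
  have P_iff: "c \<in> ?P \<longleftrightarrow> c \<le> g \<and> c \<in> (\<Union>i\<in>D. cone (m i) (Z i))" for c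
    unfolding cover by (auto simp: char_poset_def up_set_def)
  have int: "poset_interval ?P (m i) (?top i) = cone (m i) (Z i) \<inter> {..g}" if i: "i \<in> ?D" for i
  proof (intro equalityI subsetI)
    fix c assume "c \<in> poset_interval ?P (m i) (?top i)"
    then have "c \<le> g" "m i \<le> c" "\<And>j. c j \<le> ?top i j"
      by (auto simp: poset_interval_def P_iff le_fun_def)
    moreover have "c j = m i j" if "j \<notin> Z i" for j
      using calculation(3)[of j] le_funD[OF calculation(2), of j] that by simp
    ultimately show "c \<in> cone (m i) (Z i) \<inter> {..g}" by (simp add: cone_def)
  next
    fix c assume "c \<in> cone (m i) (Z i) \<inter> {..g}"
    then show "c \<in> poset_interval ?P (m i) (?top i)"
      using i by (auto simp: poset_interval_def P_iff cone_def le_fun_def)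
  qed
  have top: "m i \<le> ?top i" "?top i \<in> cone (m i) (Z i) \<inter> {..g}" if "i \<in> ?D" for i
    using that by (auto simp: cone_def le_fun_def)
  show ?thesis
    unfolding interval_partition_def
  proof (intro conjI)
    show "\<forall>(a, b)\<in>(\<lambda>i. (m i, ?top i)) ` ?D. a \<in> ?P \<and> b \<in> ?P \<and> a \<le> b"
    proof clarify
      fix i assume i: "i \<in> D" "m i \<le> g"
      then have "?top i \<in> cone (m i) (Z i)" "?top i \<le> g" "m i \<le> ?top i"
        using top[of i] by simp_all
      then show "m i \<in> ?P \<and> ?top i \<in> ?P \<and> m i \<le> ?top i"
        unfolding P_iff using i self_in_cone by blast
    qed
    show "disjoint_family_on (\<lambda>(a, b). poset_interval ?P a b) ((\<lambda>i. (m i, ?top i)) ` ?D)"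
      unfolding disjoint_family_on_def
    proof (intro ballI impI)
      fix p q assume "p \<in> (\<lambda>i. (m i, ?top i)) ` ?D" "q \<in> (\<lambda>i. (m i, ?top i)) ` ?D" "p \<noteq> q"
      then obtain i k where ik: "i \<in> ?D" "k \<in> ?D" "i \<noteq> k"
        and pq: "p = (m i, ?top i)" "q = (m k, ?top k)" by blast
      have "cone (m i) (Z i) \<inter> cone (m k) (Z k) = {}"
        using disjoint_family_onD[OF disj] ik by blast
      then show "(case p of (a, b) \<Rightarrow> poset_interval ?P a b) \<inter>
          (case q of (a, b) \<Rightarrow> poset_interval ?P a b) = {}"
        using int[OF ik(1)] int[OF ik(2)] unfolding pq by auto
    qed
    have "(\<Union>(a, b)\<in>(\<lambda>i. (m i, ?top i)) ` ?D. poset_interval ?P a b)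
        = (\<Union>i\<in>?D. cone (m i) (Z i) \<inter> {..g})"
      using int by simp
    \<comment> \<open>The discarded cones do not meet the box: an element \<open>c \<le> g\<close>
      of a cone forces its apex below \<open>g\<close>.\<close>
    also have "\<dots> = ?P"
      by (intro equalityI subsetI) (auto simp: P_iff cone_def intro: order_trans)
    finally show "?P = (\<Union>(a, b)\<in>(\<lambda>i. (m i, ?top i)) ` ?D. poset_interval ?P a b)" by simp
  qed
qed

section \<open>From interval partitions back to cones\<close>

definition cones_of_partition ::
  "('n \<Rightarrow> nat) set \<Rightarrow> ('n \<Rightarrow> nat) \<Rightarrow> (('n \<Rightarrow> nat) \<times> ('n \<Rightarrow> nat)) set \<Rightarrow>
    (('n \<Rightarrow> nat) \<times> 'n set) set" where
  "cones_of_partition P g \<P> = {(c, vars_at g d) | a d c.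
     (a, d) \<in> \<P> \<and> c \<in> poset_interval P a d \<and> (\<forall>j \<in> vars_at g d. c j = a j)}"

text \<open>The combinatorics is done with exponents and carried over to residue classes along this
  image.\<close>

lemma decomp_of_partition_eq:
  "decomp_of_partition J P g \<P> =
    (\<lambda>(c, Z). (J +>\<^bsub>mpoly_ring\<^esub> xpow c, Z)) ` cones_of_partition P g \<P>"
  unfolding decomp_of_partition_def cones_of_partition_def by force

lemma finite_cones_of_partition:
  fixes g :: "'n::finite \<Rightarrow> nat"
  shows "finite P \<Longrightarrow> finite (cones_of_partition P g \<P>)"
  by (rule finite_subset[of _ "P \<times> UNIV"]) (auto simp: cones_of_partition_def poset_interval_def)

text \<open>The lower end of an interval is itself an admissible apex, so every interval contributes
  a cone and no direction set is lost.\<close>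

lemma snd_cones_of_partition:
  assumes "interval_partition P \<P>"
  shows "snd ` cones_of_partition P g \<P> = (\<lambda>(a, d). vars_at g d) ` \<P>"
proof (intro equalityI subsetI)
  fix Z assume "Z \<in> (\<lambda>(a, d). vars_at g d) ` \<P>"
  then obtain a d where ad: "(a, d) \<in> \<P>" "Z = vars_at g d" by auto
  then have "a \<in> poset_interval P a d"
    using assms by (auto simp: interval_partition_def poset_interval_def)
  then have "(a, Z) \<in> cones_of_partition P g \<P>"
    using ad by (auto simp: cones_of_partition_def)
  then show "Z \<in> snd ` cones_of_partition P g \<P>" by force
qed (force simp: cones_of_partition_def)

lemma sdepth_decomp_of_partition:
  assumes "interval_partition P \<P>"
  shows "sdepth_decomp (decomp_of_partition J P g \<P>) = Min ((\<lambda>(a, d). card (vars_at g d)) ` \<P>)"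
proof -
  have "(\<lambda>(u, Z). card Z) ` decomp_of_partition J P g \<P> =
      card ` snd ` cones_of_partition P g \<P>"
    by (simp add: decomp_of_partition_eq image_image case_prod_unfold)
  also have "\<dots> = (\<lambda>(a, d). card (vars_at g d)) ` \<P>"
    by (simp add: snd_cones_of_partition[OF assms] image_image case_prod_unfold)
  finally show ?thesis by (simp add: sdepth_decomp_def)
qed

text \<open>For the upper bound: on \<open>vars_at g d\<close> the vectors \<open>d\<close> and
  \<open>g\<close> agree, and elsewhere \<open>e\<close> agrees with \<open>c\<close>, which is
  below \<open>d\<close>.\<close>

lemma inf_cone_bounds:
  assumes "a \<le> c" "c \<le> d" "d \<le> g" and e: "e \<in> cone c (vars_at g d)"
  shows "a \<le> inf e g" "inf e g \<le> d"
proof -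
  show "a \<le> inf e g"
    using assms by (auto simp: cone_def intro: order_trans)
  show "inf e g \<le> d"
  proof (rule le_funI)
    fix j
    show "inf e g j \<le> d j"
      using le_funD[OF assms(2), of j] e
      by (cases "j \<in> vars_at g d") (auto simp: cone_def vars_at_def intro: le_infI1)
  qed
qed

text \<open>Truncation at \<open>g\<close> sends a cone arising from the interval [a, d] into that
  interval. Thus \<open>e\<close> determines the interval containing \<open>inf e g\<close>, and
  then the apex, which is \<open>a\<close> on \<open>vars_at g d\<close> and \<open>e\<close>
  elsewhere.\<close>

lemma cones_of_partition:
  fixes A B :: "('n \<Rightarrow> nat) set"
  assumes bounds: "\<forall>a\<in>A. a \<le> g" "\<forall>b\<in>B. b \<le> g"
    and part: "interval_partition (char_poset A B g) \<P>"
  shows "disjoint_family_on (\<lambda>(a, Z). cone a Z) (cones_of_partition (char_poset A B g) g \<P>)"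
    and "(\<Union>(a, Z)\<in>cones_of_partition (char_poset A B g) g \<P>. cone a Z) = up_set A - up_set B"
proof -
  let ?P = "char_poset A B g"
  have P: "\<And>a d. (a, d) \<in> \<P> \<Longrightarrow> a \<in> ?P \<and> d \<in> ?P \<and> a \<le> d"
    and P_cover: "?P = (\<Union>(a, b)\<in>\<P>. poset_interval ?P a b)"
    and P_disj: "disjoint_family_on (\<lambda>(a, b). poset_interval ?P a b) \<P>"
    using part by (auto simp: interval_partition_def)
  have le_g: "c \<in> ?P \<Longrightarrow> c \<le> g" for c by (simp add: char_poset_def)
  \<comment> \<open>The poset is convex: a generator from \<open>A\<close> below \<open>a\<close>
    stays below \<open>c\<close>, and one from \<open>B\<close> below \<open>c\<close> would be
    below \<open>d\<close>.\<close>
  have between: "c \<in> ?P" if "a \<in> ?P" "d \<in> ?P" "a \<le> c" "c \<le> d" for a c d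
    using that by (auto simp: char_poset_def intro: order_trans)
  have interval: "inf e g \<in> poset_interval ?P a d"
    if "(a, d) \<in> \<P>" "c \<in> poset_interval ?P a d" "e \<in> cone c (vars_at g d)" for a c d e
  proof -
    have "a \<le> inf e g" "inf e g \<le> d"
      using inf_cone_bounds[OF _ _ _ that(3)] that(2) P[OF that(1)] le_g
      by (auto simp: poset_interval_def)
    then show ?thesis using P[OF that(1)] between[of a d] by (simp add: poset_interval_def)
  qed
  show "disjoint_family_on (\<lambda>(a, Z). cone a Z) (cones_of_partition ?P g \<P>)"
    unfolding disjoint_family_on_def
  proof (intro ballI impI, rule ccontr)
    fix p p' assume p: "p \<in> cones_of_partition ?P g \<P>" "p' \<in> cones_of_partition ?P g \<P>" "p \<noteq> p'"
      and "(case p of (a, Z) \<Rightarrow> cone a Z) \<inter> (case p' of (a, Z) \<Rightarrow> cone a Z) \<noteq> {}"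
    then obtain e where e: "e \<in> cone (fst p) (snd p)" "e \<in> cone (fst p') (snd p')"
      by (auto simp: case_prod_unfold)
    obtain a d where ad: "(a, d) \<in> \<P>" "fst p \<in> poset_interval ?P a d" "snd p = vars_at g d"
      "\<forall>j\<in>vars_at g d. fst p j = a j"
      using p(1) by (auto simp: cones_of_partition_def)
    obtain a' d' where ad': "(a', d') \<in> \<P>" "fst p' \<in> poset_interval ?P a' d'"
      "snd p' = vars_at g d'" "\<forall>j\<in>vars_at g d'. fst p' j = a' j"
      using p(2) by (auto simp: cones_of_partition_def)
    have "inf e g \<in> poset_interval ?P a d \<inter> poset_interval ?P a' d'"
      using interval[OF ad(1,2)] interval[OF ad'(1,2)] e ad(3) ad'(3) by auto
    then have eq: "(a, d) = (a', d')"
      using disjoint_family_onD[OF P_disj ad(1) ad'(1)] by auto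
    have "fst p j = fst p' j" for j
      using e ad(3,4) ad'(3,4) eq by (cases "j \<in> vars_at g d") (auto simp: cone_def)
    then have "fst p = fst p'" by (rule ext)
    moreover have "snd p = snd p'" using eq ad(3) ad'(3) by simp
    ultimately have "p = p'" by (rule prod_eqI)
    then show False using p(3) by simp
  qed
  show "(\<Union>(a, Z)\<in>cones_of_partition ?P g \<P>. cone a Z) = up_set A - up_set B"
  proof (intro equalityI subsetI)
    fix e assume "e \<in> (\<Union>(a, Z)\<in>cones_of_partition ?P g \<P>. cone a Z)"
    then obtain a d c where "(a, d) \<in> \<P>" "c \<in> poset_interval ?P a d" "e \<in> cone c (vars_at g d)"
      by (auto simp: cones_of_partition_def)
    then have "inf e g \<in> poset_interval ?P a d" by (rule interval)
    then have "inf e g \<in> ?P" by (simp add: poset_interval_def)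
    then show "e \<in> up_set A - up_set B" using inf_in_char_poset_iff[OF bounds] by blast
  next
    fix e assume "e \<in> up_set A - up_set B"
    then have "inf e g \<in> ?P" using inf_in_char_poset_iff[OF bounds] by blast
    then obtain a d where ad: "(a, d) \<in> \<P>" "inf e g \<in> poset_interval ?P a d"
      using P_cover by blast
    \<comment> \<open>The only possible apex: cones from [a, d] start at \<open>a\<close> on
      \<open>vars_at g d\<close> and do not move elsewhere.\<close>
    define c where "c = (\<lambda>j. if j \<in> vars_at g d then a j else e j)"
    have le: "a j \<le> e j" "min (e j) (g j) \<le> d j" "d j \<le> g j" "a j \<le> d j" for j
      using ad P[OF ad(1)] le_g[of d]
      by (auto simp: poset_interval_def le_fun_def inf_min)
    \<comment> \<open>Here \<open>d j < g j\<close>, so the minimum of \<open>e j\<close> and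
      \<open>g j\<close> can be at most \<open>d j\<close> only if \<open>e j\<close> is.\<close>
    have off: "e j \<le> d j" if "j \<notin> vars_at g d" for j
      using le(2,3)[of j] that by (auto simp: vars_at_def min_def split: if_splits)
    have "a \<le> c" "c \<le> d" using le off by (auto simp: c_def le_fun_def)
    then have "c \<in> poset_interval ?P a d"
      using P[OF ad(1)] between[of a d] by (simp add: poset_interval_def)
    then have "(c, vars_at g d) \<in> cones_of_partition ?P g \<P>"
      using ad(1) by (auto simp: cones_of_partition_def c_def)
    moreover have "e \<in> cone c (vars_at g d)"
      using le by (auto simp: cone_def c_def le_fun_def)
    ultimately show "e \<in> (\<Union>(a, Z)\<in>cones_of_partition ?P g \<P>. cone a Z)" by blast
  qed
qed

section \<open>Comparison of the two maxima of Stanley depths\<close>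

theorem theorem2p4:
  fixes A B :: "('n::finite \<Rightarrow> nat) set"
    and g :: "'n \<Rightarrow> nat"
    and I J :: "('n, 'k::field) mpoly set"
  assumes "finite A" and "finite B"
    and "I = monomial_ideal A" and "J = monomial_ideal B"
    and "J \<subset> I"
    and "\<forall>a\<in>A. a \<le> g" and "\<forall>b\<in>B. b \<le> g"
  shows
    "(\<forall>D. stanley_decomposition (quot_module I J) (quot_component I J) D \<longrightarrow>
        (\<exists>\<P>. interval_partition (char_poset A B g) \<P> \<and>
             sdepth_decomp (decomp_of_partition J (char_poset A B g) g \<P>) \<ge> sdepth_decomp D)) \<and>
     finite {\<P>. interval_partition (char_poset A B g) \<P>} \<and>
     {\<P>. interval_partition (char_poset A B g) \<P>} \<noteq> {} \<and>
     sdepth (quot_module I J) (quot_component I J) =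
       Max {sdepth_decomp (decomp_of_partition J (char_poset A B g) g \<P>) | \<P>.
              interval_partition (char_poset A B g) \<P>}"
proof -
  interpret monomial_quotient A B I J
    using assms(3-5) by unfold_locales
  note bounds = assms(6,7)
  let ?P = "char_poset A B g"
  let ?sd = "\<lambda>\<P>. sdepth_decomp (decomp_of_partition J ?P g \<P>)"
  have "\<exists>e. e \<in> up_set A - up_set B" using up_set_subset by blast
  \<comment> \<open>Nonemptiness passes to every partition and makes the \<open>Min\<close> in its
    Stanley depth meaningful.\<close>
  then have P_ne: "?P \<noteq> {}" using inf_in_char_poset_iff[OF bounds] by blast
  have part1: "\<exists>\<P>. interval_partition ?P \<P> \<and> ?sd \<P> \<ge> sdepth_decomp D"
    if D: "stanley_decomposition (quot_module I J) (quot_component I J) D" for D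
  proof -
    obtain m where m: "disjoint_family_on (\<lambda>i. cone (m i) (snd i)) D"
      "(\<Union>i\<in>D. cone (m i) (snd i)) = up_set A - up_set B"
      using stanley_decomposition_imp_cones[OF D] unfolding E_def by blast
    define \<P> where
      "\<P> = (\<lambda>i. (m i, \<lambda>j. if j \<in> snd i then g j else m i j)) ` {i \<in> D. m i \<le> g}"
    have part: "interval_partition ?P \<P>"
      unfolding \<P>_def by (rule interval_partition_of_cones[OF bounds m])
    have finD: "finite D" using D by (simp add: stanley_decomposition_def)
    then have "finite \<P>" by (simp add: \<P>_def)
    moreover have "\<P> \<noteq> {}" using part P_ne by (auto simp: interval_partition_def)
    moreover have "sdepth_decomp D \<le> card (vars_at g d)" if "(a, d) \<in> \<P>" for a d
    proof -
      obtain i where i: "i \<in> D" "d = (\<lambda>j. if j \<in> snd i then g j else m i j)"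
        using \<open>(a, d) \<in> \<P>\<close> by (auto simp: \<P>_def)
      have "sdepth_decomp D \<le> card (snd i)"
        unfolding sdepth_decomp_def using finD i(1) by (intro Min_le) (auto simp: case_prod_unfold)
      \<comment> \<open>The upper end \<open>d\<close> equals \<open>g\<close> on
        \<open>snd i\<close> by construction. It may reach \<open>g\<close> in further coordinates,
        where \<open>m i\<close> does, so only an inequality holds.\<close>
      also have "\<dots> \<le> card (vars_at g d)"
        by (rule card_mono) (auto simp: vars_at_def i(2))
      finally show ?thesis .
    qed
    ultimately have "sdepth_decomp D \<le> ?sd \<P>"
      unfolding sdepth_decomp_of_partition[OF part] by (subst Min_ge_iff) auto
    then show ?thesis using part by blast
  qed
  have part2: "stanley_decomposition (quot_module I J) (quot_component I J)
      (decomp_of_partition J ?P g \<P>)" if part: "interval_partition ?P \<P>" for \<P>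
    unfolding decomp_of_partition_eq
    using cones_of_partition[OF bounds part] finite_char_poset
    by (intro cones_imp_stanley_decomposition finite_cones_of_partition) (simp_all add: E_def)
  have fin: "finite {\<P>. interval_partition ?P \<P>}"
    by (rule finite_subset[of _ "Pow (?P \<times> ?P)"])
      (use interval_partition_subset in \<open>auto intro!: finite_cartesian_product finite_char_poset\<close>)
  have ne: "{\<P>. interval_partition ?P \<P>} \<noteq> {}"
    using interval_partition_singletons by blast
  let ?S = "{?sd \<P> | \<P>. interval_partition ?P \<P>}"
  let ?R = "{sdepth_decomp D | D. stanley_decomposition (quot_module I J) (quot_component I J) D}"
  have finS: "finite ?S" using fin by simp
  have neS: "?S \<noteq> {}" using ne by blast
  have sub: "?S \<subseteq> ?R" using part2 by blast
  have le: "r \<le> Max ?S" if r: "r \<in> ?R" for r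
  proof -
    obtain \<P> where "interval_partition ?P \<P>" "r \<le> ?sd \<P>" using r part1 by blast
    then show ?thesis using Max_ge[OF finS, of "?sd \<P>"] by force
  qed
  have "Max ?R = Max ?S"
  proof (rule Max_eqI)
    \<comment> \<open>\<open>Max ?R\<close> is meaningful only for a finite set; the bound by
      \<open>Max ?S\<close> supplies finiteness.\<close>
    show "finite ?R" by (rule finite_subset[of _ "{..Max ?S}"]) (use le in auto)
    show "Max ?S \<in> ?R" using Max_in[OF finS neS] sub by blast
  qed (rule le)
  then show ?thesis using part1 fin ne unfolding sdepth_def by blast
qed

end
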